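(* Let $n\in\{1,\dots,\ell\}$ and define the matrices $B,C,D\in\mathbb{R}^{(\tilde d-d)\times(\tilde d-d)}$, with rows and columns indexed by $\{d+1,\dots,\tilde d\}$, as $$B=\mathrm{diag}(b_{d+1},\dots,b_{\tilde d}),\qquad C_{ij}=\zeta_{n-1}^j(\lambda_i),\qquad D=\mathrm{diag}\big(\|\zeta_{n-1}^{d+1}\|^2,\dots,\|\zeta_{n-1}^{\tilde d}\|^2\big).$$ Also define $w=(\pi_n(\lambda_{d+1}),\dots,\pi_n(\lambda_{\tilde d}))^\top$. Then the matrix $D+B^2C$ is invertible and $$\tilde\pi_n=\pi_n-\sum_{j=d+1}^{\tilde d}\sigma_j\,\zeta_{n-1}^j,\qquad\text{where }\sigma=(D+B^2C)^{-1}B^2w.$$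
   Context: Let $\tilde d\ge d$ be positive integers, $\lambda_1,\dots,\lambda_{\tilde d}\in\mathbb{R}$ and $b_1,\dots,b_{\tilde d}\in\mathbb{R}$ (no sign or ordering assumption). Let $A=\mathrm{diag}(\lambda_1,\dots,\lambda_d)$ and $b=(b_1,\dots,b_d)^\top$. The grade $\ell$ of $(A,b)$ is the largest integer $n$ such that $\mathrm{span}\{b,Ab,\dots,A^{n-1}b\}$ has dimension $n$. $\mathcal{P}_{\le n}$ is the space of real univariate polynomials of degree at most $n$. On polynomials define the semi-inner products $$\langle p,q\rangle=\sum_{i=1}^d b_i^2p(\lambda_i)q(\lambda_i),\qquad\langle p,q\rangle_\sim=\sum_{i=1}^{\tilde d}b_i^2p(\lambda_i)q(\lambda_i),$$ with induced semi-norms $\|\cdot\|$ and $\|\cdot\|_\sim$. For $n\le\ell$, $\pi_n$ (resp. $\tilde\pi_n$) is the unique minimizer of $\|\pi\|^2$ (resp. $\|\pi\|_\sim^2$) over $\pi\in\mathcal{P}_{\le n}$ whose coefficient of degree $n$ equals $1$. For $d<j\le\tilde d$ and $0\le n<\ell$, $\zeta_n^j$ is the unique minimizer of $\|\zeta\|^2$ over $\zeta\in\mathcal{P}_{\le n}$ subject to $\zeta(\lambda_j)=1$. *)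

theory Defs
  imports
    "HOL-Computational_Algebra.Polynomial"
    "Jordan_Normal_Form.DL_Rank"
    "Jordan_Normal_Form.Gauss_Jordan_Elimination"
begin

(* The empty family (k = 0) spans the zero space, so the grade of (A, 0) is 0. For square A the
   dimensions are bounded by n, hence GREATEST is a genuine maximum. *)
definition (in vec_space) grade :: "'a mat \<Rightarrow> 'a vec \<Rightarrow> nat" where
  "grade A v =
    (GREATEST k. vectorspace.dim class_ring (span_vs ((\<lambda>i. A ^\<^sub>m i *\<^sub>v v) ` {..<k})) = k)"

(* Nodes lam 1, lam 2, ... and weights b 1, b 2, ...: the indices start at 1, and only those up to N
   matter. Taking N = d gives the semi-inner product without tilde, N = d' (d-tilde) the one with
   tilde. *)
definition semi_inner ::
  "nat \<Rightarrow> (nat \<Rightarrow> real) \<Rightarrow> (nat \<Rightarrow> real) \<Rightarrow> real poly \<Rightarrow> real poly \<Rightarrow> real" where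
  "semi_inner N lam b p q = (\<Sum>i=1..N. (b i)\<^sup>2 * poly p (lam i) * poly q (lam i))"

definition semi_norm :: "nat \<Rightarrow> (nat \<Rightarrow> real) \<Rightarrow> (nat \<Rightarrow> real) \<Rightarrow> real poly \<Rightarrow> real" where
  "semi_norm N lam b p = sqrt (semi_inner N lam b p p)"

(* The definite descriptions below denote the minimizer only when it exists and is unique:
   for monic_min when n is at most the grade of the first N data, for zeta when n is less than it. *)
definition monic_min :: "nat \<Rightarrow> (nat \<Rightarrow> real) \<Rightarrow> (nat \<Rightarrow> real) \<Rightarrow> nat \<Rightarrow> real poly" where
  "monic_min N lam b n =
    (THE p. is_arg_min (\<lambda>q. (semi_norm N lam b q)\<^sup>2) (\<lambda>q. degree q \<le> n \<and> coeff q n = 1) p)"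

definition zeta :: "nat \<Rightarrow> (nat \<Rightarrow> real) \<Rightarrow> (nat \<Rightarrow> real) \<Rightarrow> nat \<Rightarrow> nat \<Rightarrow> real poly" where
  "zeta N lam b n j =
    (THE p. is_arg_min (\<lambda>q. (semi_norm N lam b q)\<^sup>2) (\<lambda>q. degree q \<le> n \<and> poly q (lam j) = 1) p)"

end

theory Submission
  imports Defs
begin

text \<open>
  Up to the grade, the first semi-inner product is definite on the polynomials of degree at most
  \<open>n - 1\<close>, and hence so is the second one. Therefore \<open>\<pi>\<^sub>n\<close> is the monic polynomial orthogonal to this
  space, and \<open>\<zeta>\<^sup>j\<close> is a multiple of the Riesz representative of the evaluation at \<open>\<lambda>\<^sub>j\<close>:
  \<open>\<langle>\<zeta>\<^sup>j, p\<rangle> = \<parallel>\<zeta>\<^sup>j\<parallel>\<^sup>2 p(\<lambda>\<^sub>j)\<close>. For \<open>f = \<Sum>\<^sub>j x\<^sub>j \<zeta>\<^sup>j\<close> and \<open>p\<close> in this space, it follows that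
  \<open>\<langle>f, p\<rangle>\<^sub>\<sim> = \<Sum>\<^sub>j p(\<lambda>\<^sub>j) ((D + B\<^sup>2C) x)\<^sub>j\<close>. Definiteness turns this into injectivity of \<open>D + B\<^sup>2C\<close>, and
  with \<open>\<langle>\<pi>\<^sub>n, p\<rangle>\<^sub>\<sim> = \<Sum>\<^sub>j p(\<lambda>\<^sub>j) (B\<^sup>2w)\<^sub>j\<close> it shows that \<open>\<pi>\<^sub>n - \<Sum>\<^sub>j \<sigma>\<^sub>j \<zeta>\<^sup>j\<close> is orthogonal to the space for
  the second product.
\<close>

section \<open>Ranks, and the grade as the dimension of a Krylov space\<close>

lemma (in vec_space) rank_le_nr:
  assumes "A \<in> carrier_mat n nc"
  shows "rank A \<le> n"
proof -
  obtain S where S: "maximal S (\<lambda>T. T \<subseteq> set (cols A) \<and> lin_indpt T)"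
    using maximal_exists_superset[of "set (cols A)" "\<lambda>T. T \<subseteq> set (cols A) \<and> lin_indpt T" "{}"]
    by (metis List.finite_set empty_subsetI finite_lin_indpt2 finite.emptyI empty_iff)
  then have "S \<subseteq> set (cols A)" "lin_indpt S"
    by (auto simp: maximal_def)
  then have "card S \<le> n"
    using li_le_dim(2)[of S] cols_dim[of A] assms dim_is_n fin_dim by auto
  then show ?thesis
    using rank_card_indpt[OF assms S] by simp
qed

text \<open>Linear independence is a property of the set of columns, which would hide a repetition.
  The rank counts a maximal independent subset of that set, so a repeated column would push it below
  \<open>nc\<close>.\<close>

lemma (in vec_space) full_rank_distinct_cols:
  assumes "A \<in> carrier_mat n nc" and "rank A = nc"
  shows "distinct (cols A)"
proof -
  obtain S where S: "maximal S (\<lambda>T. T \<subseteq> set (cols A) \<and> lin_indpt T)"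
    using maximal_exists_superset[of "set (cols A)" "\<lambda>T. T \<subseteq> set (cols A) \<and> lin_indpt T" "{}"]
    by (metis List.finite_set empty_subsetI finite_lin_indpt2 finite.emptyI empty_iff)
  then have "card S \<le> card (set (cols A))"
    by (auto simp: maximal_def intro: card_mono)
  then have "nc \<le> card (set (cols A))"
    using rank_card_indpt[OF assms(1) S] assms(2) by simp
  moreover have "card (set (cols A)) \<le> length (cols A)"
    by (rule card_length)
  ultimately show ?thesis
    using assms(1) by (intro card_distinct) auto
qed

lemma (in vec_space) full_rank_kernel_trivial:
  assumes "A \<in> carrier_mat n nc" and "rank A = nc"
    and "v \<in> carrier_vec nc" and "A *\<^sub>v v = 0\<^sub>v n"
  shows "v = 0\<^sub>v nc"
  using full_rank_distinct_cols[OF assms(1,2)] full_rank_lin_indpt[OF assms(1,2)] lin_depI assms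
  by blast

text \<open>\<open>GREATEST\<close> is attained once some \<open>k\<close> qualifies and all
  qualifying \<open>k\<close> are bounded. The empty family settles \<open>k = 0\<close>, and any
  qualifying \<open>k\<close> is the rank of a matrix with \<open>n\<close> rows.\<close>

lemma (in vec_space) dim_span_krylov_grade:
  assumes A: "A \<in> carrier_mat n n" and v: "v \<in> carrier_vec n"
  shows "vectorspace.dim class_ring
    (span_vs ((\<lambda>i. A ^\<^sub>m i *\<^sub>v v) ` {..<grade A v})) = grade A v" (is "?dim (grade A v) = _")
proof -
  have bound: "k \<le> n" if "?dim k = k" for k
  proof -
    define K where "K = mat_of_cols n (map (\<lambda>i. A ^\<^sub>m i *\<^sub>v v) [0..<k])"
    have "cols K = map (\<lambda>i. A ^\<^sub>m i *\<^sub>v v) [0..<k]"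
      unfolding K_def by (rule cols_mat_of_cols) (use mult_mat_vec_carrier[OF pow_carrier_mat[OF A] v] in auto)
    then have "rank K = k"
      using that by (simp add: rank_def atLeast0LessThan)
    then show ?thesis
      using rank_le_nr[of K k] unfolding K_def by fastforce
  qed
  have "?dim 0 = 0"
    using dim_span[of "{}" "{}"] finite_lin_indpt2[of "{}"] by (simp add: maximal_def)
  then show ?thesis
    unfolding grade_def using bound by (rule GreatestI_nat)
qed

lemma mat_diag_pow: "mat_diag n f ^\<^sub>m k = mat_diag n (\<lambda>i. f i ^ k)"
  by (induction k) (simp_all add: carrier_matD(1)[OF mat_diag_dim] power_Suc2 del: power_Suc)

section \<open>Algebra of the semi-inner products\<close>

lemma semi_inner_commute: "semi_inner N lam b p q = semi_inner N lam b q p"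
  by (simp add: semi_inner_def mult_ac)

lemma semi_inner_add_left:
  "semi_inner N lam b (p + q) r = semi_inner N lam b p r + semi_inner N lam b q r"
  by (simp add: semi_inner_def algebra_simps sum.distrib)

lemma semi_inner_diff_left:
  "semi_inner N lam b (p - q) r = semi_inner N lam b p r - semi_inner N lam b q r"
  by (simp add: semi_inner_def algebra_simps sum_subtractf)

lemma semi_inner_smult_left:
  "semi_inner N lam b (Polynomial.smult c p) r = c * semi_inner N lam b p r"
  by (simp add: semi_inner_def sum_distrib_left mult_ac)

lemma semi_inner_zero_left [simp]: "semi_inner N lam b 0 r = 0"
  by (simp add: semi_inner_def)

lemma semi_inner_sum_left:
  "semi_inner N lam b (\<Sum>i\<in>I. f i) r = (\<Sum>i\<in>I. semi_inner N lam b (f i) r)"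
  by (induction I rule: infinite_finite_induct) (simp_all add: semi_inner_add_left)

lemma semi_inner_add_right:
  "semi_inner N lam b r (p + q) = semi_inner N lam b r p + semi_inner N lam b r q"
  by (simp add: semi_inner_commute[of N lam b r] semi_inner_add_left)

lemma semi_inner_diff_right:
  "semi_inner N lam b r (p - q) = semi_inner N lam b r p - semi_inner N lam b r q"
  by (simp add: semi_inner_commute[of N lam b r] semi_inner_diff_left)

lemma semi_inner_smult_right:
  "semi_inner N lam b r (Polynomial.smult c p) = c * semi_inner N lam b r p"
  by (simp add: semi_inner_commute[of N lam b r] semi_inner_smult_left)

lemma semi_inner_self_nonneg: "0 \<le> semi_inner N lam b p p"
  unfolding semi_inner_def by (intro sum_nonneg) (simp add: mult.assoc)

lemma semi_norm_power2: "(semi_norm N lam b p)\<^sup>2 = semi_inner N lam b p p"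
  by (simp add: semi_norm_def semi_inner_self_nonneg)

lemma semi_inner_split:
  assumes "d \<le> d'"
  shows "semi_inner d' lam b p q =
    semi_inner d lam b p q + (\<Sum>i=d+1..d'. (b i)\<^sup>2 * poly p (lam i) * poly q (lam i))"
proof -
  have "{1..d'} = {1..d} \<union> {d+1..d'}"
    using assms by auto
  then show ?thesis
    unfolding semi_inner_def by (simp add: sum.union_disjoint)
qed

section \<open>Definiteness on polynomials of low degree\<close>

definition definite_upto :: "nat \<Rightarrow> (nat \<Rightarrow> real) \<Rightarrow> (nat \<Rightarrow> real) \<Rightarrow> nat \<Rightarrow> bool" where
  "definite_upto N lam b m \<longleftrightarrow> (\<forall>p. degree p \<le> m \<longrightarrow> semi_inner N lam b p p = 0 \<longrightarrow> p = 0)"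

lemma definite_uptoD:
  "definite_upto N lam b m \<Longrightarrow> degree p \<le> m \<Longrightarrow> semi_inner N lam b p p = 0 \<Longrightarrow> p = 0"
  by (simp add: definite_upto_def)

lemma definite_upto_mono_nodes:
  assumes "definite_upto d lam b m" and "d \<le> d'"
  shows "definite_upto d' lam b m"
  unfolding definite_upto_def
proof (intro allI impI)
  fix p assume p: "degree p \<le> m" "semi_inner d' lam b p p = 0"
  \<comment> \<open>The added nodes contribute squares, so a null polynomial for \<open>d'\<close>
    is null for \<open>d\<close>.\<close>
  have "0 \<le> (\<Sum>i=d+1..d'. (b i)\<^sup>2 * poly p (lam i) * poly p (lam i))"
    by (intro sum_nonneg) (simp add: mult.assoc)
  then have "semi_inner d lam b p p = 0"
    using semi_inner_split[OF assms(2), of lam b p p] semi_inner_self_nonneg[of d lam b p] p(2)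
    by linarith
  then show "p = 0"
    using assms(1) p(1) by (rule definite_uptoD[rotated 2])
qed

text \<open>A null polynomial vanishes at every node of nonzero weight, that is, p(A)v = 0. Its
  coefficients then form a kernel vector of the Krylov matrix, whose columns are independent up to
  the grade.\<close>

lemma definite_below_grade:
  assumes "n \<in> {1..vec_space.grade d (mat_diag d (\<lambda>i. lam (i + 1))) (vec d (\<lambda>i. b (i + 1)))}"
  shows "definite_upto d lam b (n - 1)"
  unfolding definite_upto_def
proof (intro allI impI)
  fix p :: "real poly"
  assume deg: "degree p \<le> n - 1" and zero: "semi_inner d lam b p p = 0"
  define A where "A = mat_diag d (\<lambda>i. lam (i + 1))"
  define v where "v = vec d (\<lambda>i. b (i + 1))"
  define g where "g = vec_space.grade d A v"
  define K where "K = mat_of_cols d (map (\<lambda>k. A ^\<^sub>m k *\<^sub>v v) [0..<g])"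
  interpret vec_space "TYPE(real)" d .
  have A: "A \<in> carrier_mat d d" and v: "v \<in> carrier_vec d"
    by (simp_all add: A_def v_def)
  \<comment> \<open>Strict because \<open>1 \<le> n\<close>, which also keeps \<open>n - 1\<close>
    from being truncated.\<close>
  have deg: "degree p < g"
    using assms deg unfolding g_def A_def v_def atLeastAtMost_iff by linarith
  have K: "K \<in> carrier_mat d g"
    unfolding K_def using mat_of_cols_carrier(1)[of d "map (\<lambda>k. A ^\<^sub>m k *\<^sub>v v) [0..<g]"] by simp
  have "cols K = map (\<lambda>k. A ^\<^sub>m k *\<^sub>v v) [0..<g]"
    unfolding K_def by (rule cols_mat_of_cols) (use mult_mat_vec_carrier[OF pow_carrier_mat[OF A] v] in auto)
  then have rank: "rank K = g"
    using dim_span_krylov_grade[OF A v] by (simp add: rank_def atLeast0LessThan g_def)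
  have krylov: "(A ^\<^sub>m k *\<^sub>v v) $ i = lam (i + 1) ^ k * b (i + 1)" if "i < d" for i k
  proof -
    have "(A ^\<^sub>m k *\<^sub>v v) $ i =
        (\<Sum>j\<in>{0..<d}. (if i = j then lam (Suc j) ^ k else 0) * b (Suc j))"
      using that unfolding A_def v_def mat_diag_pow
      by (simp add: mat_diag_def scalar_prod_def)
    also have "\<dots> = (\<Sum>j\<in>{0..<d}. if i = j then lam (Suc j) ^ k * b (Suc j) else 0)"
      by (intro sum.cong) auto
    finally show ?thesis
      using that by simp
  qed
  have vanish: "b i * poly p (lam i) = 0" if "i \<in> {1..d}" for i
  proof -
    have "(b i)\<^sup>2 * poly p (lam i) * poly p (lam i) = 0"
      using zero that unfolding semi_inner_def
      by (subst (asm) sum_nonneg_eq_0_iff) (auto simp: mult.assoc)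
    then show ?thesis by simp
  qed
  \<comment> \<open>The columns of \<open>K\<close> are the Krylov vectors, so this product is
    p(A)v. Vector entries count from 0 and nodes from 1, hence the shift to
    \<open>i + 1\<close>.\<close>
  have "K *\<^sub>v vec g (coeff p) = 0\<^sub>v d"
  proof (rule eq_vecI)
    fix i assume "i < dim_vec (0\<^sub>v d :: real vec)"
    then have i: "i < d" by simp
    have "(K *\<^sub>v vec g (coeff p)) $ i = (\<Sum>k<g. lam (i + 1) ^ k * b (i + 1) * coeff p k)"
      using i krylov[OF i] by (simp add: K_def scalar_prod_def mat_of_cols_def atLeast0LessThan)
    also have "\<dots> = b (i + 1) * (\<Sum>k<g. coeff p k * lam (i + 1) ^ k)"
      by (simp add: sum_distrib_left mult_ac)
    also have "(\<Sum>k<g. coeff p k * lam (i + 1) ^ k) = poly p (lam (i + 1))"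
      unfolding poly_altdef using deg
      by (intro sum.mono_neutral_right) (auto simp: coeff_eq_0)
    finally show "(K *\<^sub>v vec g (coeff p)) $ i = 0\<^sub>v d $ i"
      using vanish[of "i + 1"] i by simp
  qed (simp add: K_def)
  then have "vec g (coeff p) = 0\<^sub>v g"
    by (rule full_rank_kernel_trivial[OF K rank, rotated]) simp
  \<comment> \<open>As \<open>degree p < g\<close>, the leading coefficient is an entry of this zero
    vector.\<close>
  then have "coeff p (degree p) = 0"
    using deg by (metis index_vec index_zero_vec(1))
  then show "p = 0" by simp
qed

section \<open>Riesz representatives and the characterization of the minimizers\<close>

text \<open>Gram-Schmidt as an induction on the degree. The functional stays arbitrary because the
  step uses the hypothesis twice: for \<open>\<phi>\<close> and for the pairing with the next
  monomial.\<close>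

lemma riesz_poly:
  fixes \<phi> :: "real poly \<Rightarrow> real"
  assumes "definite_upto N lam b m"
    and add: "\<And>p q. \<phi> (p + q) = \<phi> p + \<phi> q"
    and smult: "\<And>c p. \<phi> (Polynomial.smult c p) = c * \<phi> p"
  obtains r where "degree r \<le> m" and "\<And>p. degree p \<le> m \<Longrightarrow> semi_inner N lam b r p = \<phi> p"
  using assms
proof (induction m arbitrary: \<phi> thesis)
  case 0
  define g where "g = semi_inner N lam b 1 1"
  have "g \<noteq> 0"
    using definite_uptoD[OF "0.prems"(2), of 1] by (auto simp: g_def)
  have "semi_inner N lam b [:\<phi> 1 / g:] p = \<phi> p" if "degree p \<le> 0" for p
  proof -
    define a where "a = coeff p 0"
    have a: "p = [:a:]"
      using degree_0_id[of p] that by (simp add: a_def)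
    have "semi_inner N lam b [:c:] p = c * a * g" for c
      by (simp add: a g_def semi_inner_def sum_distrib_left mult_ac)
    moreover have "\<phi> p = a * \<phi> 1"
      using "0.prems"(4)[of a 1] by (simp add: a)
    ultimately show ?thesis
      using \<open>g \<noteq> 0\<close> by simp
  qed
  then show ?case
    by (intro "0.prems"(1)[of "[:\<phi> 1 / g:]"]) auto
next
  case (Suc m)
  let ?I = "semi_inner N lam b"
  have def: "definite_upto N lam b m"
    using Suc.prems(2) by (simp add: definite_upto_def)
  \<comment> \<open>\<open>s\<close> is the orthogonal projection of the next monomial to degree at
    most \<open>m\<close>, so \<open>e\<close> below is monic and orthogonal to that space.\<close>
  obtain s where s: "degree s \<le> m" "\<And>p. degree p \<le> m \<Longrightarrow> ?I s p = ?I (monom 1 (Suc m)) p"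
    by (rule Suc.IH[of "?I (monom 1 (Suc m))"])
      (auto simp: def semi_inner_add_right semi_inner_smult_right)
  obtain r where r: "degree r \<le> m" "\<And>p. degree p \<le> m \<Longrightarrow> ?I r p = \<phi> p"
    by (rule Suc.IH[of \<phi>]) (auto simp: def Suc.prems)
  define e where "e = monom 1 (Suc m) - s"
  have deg_e: "degree e \<le> Suc m"
    unfolding e_def using s(1) by (intro degree_diff_le) (auto simp: degree_monom_le)
  have coeff_e: "coeff e (Suc m) = 1"
    using s(1) by (simp add: e_def coeff_eq_0)
  have orth: "?I e p = 0" if "degree p \<le> m" for p
    using s(2)[OF that] by (simp add: e_def semi_inner_diff_left)
  have "?I e e \<noteq> 0"
    using definite_uptoD[OF Suc.prems(2) deg_e] coeff_e by auto
  \<comment> \<open>The new term is orthogonal to degree at most \<open>m\<close>, where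
    \<open>r\<close> is already right. Since \<open>?I r e = 0\<close>, its factor is dictated by
    \<open>?I t e = \<phi> e\<close>.\<close>
  define t where "t = r + Polynomial.smult (\<phi> e / ?I e e) e"
  have "?I t p = \<phi> p" if p: "degree p \<le> Suc m" for p
  proof -
    define q where "q = p - Polynomial.smult (coeff p (Suc m)) e"
    have "degree q \<le> m"
    proof (rule degree_le, intro allI impI)
      fix i assume "m < i"
      then consider "i = Suc m" | "Suc m < i" by linarith
      then show "coeff q i = 0"
        by cases (use coeff_e deg_e p in \<open>auto simp: q_def coeff_eq_0\<close>)
    qed
    then have "?I t q = \<phi> q"
      using orth[of q] r(2)[of q] by (simp add: t_def semi_inner_add_left semi_inner_smult_left)
    moreover have "?I t e = \<phi> e"
      using orth[OF r(1)] \<open>?I e e \<noteq> 0\<close> semi_inner_commute[of N lam b r e]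
      by (simp add: t_def semi_inner_add_left semi_inner_smult_left)
    ultimately have "?I t (q + Polynomial.smult (coeff p (Suc m)) e) =
        \<phi> (q + Polynomial.smult (coeff p (Suc m)) e)"
      by (simp add: semi_inner_add_right semi_inner_smult_right Suc.prems(3,4))
    then show ?thesis
      by (simp add: q_def)
  qed
  moreover have "degree t \<le> Suc m"
    unfolding t_def using r(1) deg_e by (intro degree_add_le) (auto intro: degree_smult_le order_trans)
  ultimately show ?case
    using Suc.prems(1) by blast
qed

text \<open>Common to both kinds of minimizers: feasible directions are orthogonal to
  \<open>p\<close>, so Pythagoras makes \<open>p\<close> minimal, and definiteness at
  \<open>q - p\<close> makes it the only minimizer, as \<open>THE\<close> demands.\<close>

lemma the_arg_min_semi_norm:
  assumes "definite_upto N lam b m" and "F p"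
    and orth: "\<And>q. F q \<Longrightarrow> degree (q - p) \<le> m \<and> semi_inner N lam b p (q - p) = 0"
  shows "(THE p. is_arg_min (\<lambda>q. (semi_norm N lam b q)\<^sup>2) F p) = p"
proof (rule the_equality)
  have pythagoras:
    "semi_inner N lam b q q = semi_inner N lam b p p + semi_inner N lam b (q - p) (q - p)"
    if "F q" for q
    using orth[OF that] semi_inner_commute[of N lam b p q]
    by (simp add: semi_inner_diff_left semi_inner_diff_right)
  show "is_arg_min (\<lambda>q. (semi_norm N lam b q)\<^sup>2) F p"
    unfolding is_arg_min_linorder semi_norm_power2
  proof (intro conjI allI impI \<open>F p\<close>)
    show "semi_inner N lam b p p \<le> semi_inner N lam b q q" if "F q" for q
      using pythagoras[OF that] semi_inner_self_nonneg[of N lam b "q - p"] by linarith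
  qed
  fix q assume q: "is_arg_min (\<lambda>q. (semi_norm N lam b q)\<^sup>2) F q"
  then have "F q" "semi_inner N lam b q q \<le> semi_inner N lam b p p"
    using \<open>F p\<close> by (auto simp: is_arg_min_linorder semi_norm_power2)
  then have "semi_inner N lam b (q - p) (q - p) = 0"
    using pythagoras[of q] semi_inner_self_nonneg[of N lam b "q - p"] by linarith
  then show "q = p"
    using definite_uptoD[OF assms(1), of "q - p"] orth[OF \<open>F q\<close>] by simp
qed

text \<open>Two candidates share the coefficient of degree \<open>Suc m\<close>, so they differ by
  degree at most \<open>m\<close> and orthogonality there suffices. It serves twice: to identify the
  minimizer in general and to verify the final formula for \<open>d'\<close>.\<close>

lemma monic_min_eqI:
  assumes "definite_upto N lam b m"
    and "degree p \<le> Suc m" and "coeff p (Suc m) = 1"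
    and "\<And>q. degree q \<le> m \<Longrightarrow> semi_inner N lam b p q = 0"
  shows "monic_min N lam b (Suc m) = p"
  unfolding monic_min_def
proof (rule the_arg_min_semi_norm[OF assms(1)])
  fix q :: "real poly"
  assume q: "degree q \<le> Suc m \<and> coeff q (Suc m) = 1"
  have "degree (q - p) \<le> m"
  proof (rule degree_le, intro allI impI)
    fix i assume "m < i"
    then consider "i = Suc m" | "Suc m < i" by linarith
    then show "coeff (q - p) i = 0"
      by cases (use q assms in \<open>auto simp: coeff_eq_0\<close>)
  qed
  then show "degree (q - p) \<le> m \<and> semi_inner N lam b p (q - p) = 0"
    using assms(4) by blast
qed (use assms in simp)

text \<open>The minimizer is the monomial minus its orthogonal projection to degree at most
  \<open>m\<close>, which \<open>riesz_poly\<close> supplies.\<close>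

lemma monic_min_orthogonal:
  assumes "definite_upto N lam b m"
  shows "degree (monic_min N lam b (Suc m)) \<le> Suc m"
    and "coeff (monic_min N lam b (Suc m)) (Suc m) = 1"
    and "degree q \<le> m \<Longrightarrow> semi_inner N lam b (monic_min N lam b (Suc m)) q = 0"
proof -
  obtain s where s: "degree s \<le> m"
    "\<And>p. degree p \<le> m \<Longrightarrow> semi_inner N lam b s p = semi_inner N lam b (monom 1 (Suc m)) p"
    by (rule riesz_poly[OF assms, of "semi_inner N lam b (monom 1 (Suc m))"])
      (auto simp: semi_inner_add_right semi_inner_smult_right)
  define e where "e = monom 1 (Suc m) - s"
  have deg: "degree e \<le> Suc m"
    unfolding e_def using s(1) by (intro degree_diff_le) (auto simp: degree_monom_le)
  have monic: "coeff e (Suc m) = 1"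
    using s(1) by (simp add: e_def coeff_eq_0)
  have orth: "semi_inner N lam b e p = 0" if "degree p \<le> m" for p
    using s(2)[OF that] by (simp add: e_def semi_inner_diff_left)
  have "monic_min N lam b (Suc m) = e"
    using assms deg monic orth by (rule monic_min_eqI)
  then show "degree (monic_min N lam b (Suc m)) \<le> Suc m"
    and "coeff (monic_min N lam b (Suc m)) (Suc m) = 1"
    and "degree q \<le> m \<Longrightarrow> semi_inner N lam b (monic_min N lam b (Suc m)) q = 0"
    using deg monic orth by simp_all
qed

text \<open>The Riesz representative \<open>r\<close> of the evaluation at \<open>lam j\<close> is
  scaled to take the value 1 there. Feasible polynomials differ by one that vanishes at
  \<open>lam j\<close>, hence is orthogonal to \<open>r\<close>.\<close>

lemma zeta_reproducing:
  assumes "definite_upto N lam b m"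
  shows "degree (zeta N lam b m j) \<le> m"
    and "semi_inner N lam b (zeta N lam b m j) (zeta N lam b m j) \<noteq> 0"
    and "degree p \<le> m \<Longrightarrow> semi_inner N lam b (zeta N lam b m j) p =
      (semi_norm N lam b (zeta N lam b m j))\<^sup>2 * poly p (lam j)"
proof -
  obtain r where r: "degree r \<le> m"
    "\<And>p. degree p \<le> m \<Longrightarrow> semi_inner N lam b r p = poly p (lam j)"
    by (rule riesz_poly[OF assms, of "\<lambda>p. poly p (lam j)"]) auto
  define c where "c = poly r (lam j)"
  have "r \<noteq> 0"
    using r(2)[of 1] by auto
  \<comment> \<open>Representing the evaluation of \<open>r\<close> itself shows that
    \<open>c\<close> is the squared norm of \<open>r\<close>.\<close>
  then have "c \<noteq> 0"
    using definite_uptoD[OF assms r(1)] r(2)[OF r(1)] by (auto simp: c_def)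
  define z where "z = Polynomial.smult (1 / c) r"
  have deg: "degree z \<le> m"
    using r(1) by (simp add: z_def)
  have z: "poly z (lam j) = 1"
    using \<open>c \<noteq> 0\<close> by (simp add: z_def c_def)
  have repr: "semi_inner N lam b z p = poly p (lam j) / c" if "degree p \<le> m" for p
    using r(2)[OF that] by (simp add: z_def semi_inner_smult_left)
  have "zeta N lam b m j = z"
    unfolding zeta_def
  proof (rule the_arg_min_semi_norm[OF assms])
    fix q assume q: "degree q \<le> m \<and> poly q (lam j) = 1"
    then have "degree (q - z) \<le> m"
      using deg by (intro degree_diff_le) auto
    then show "degree (q - z) \<le> m \<and> semi_inner N lam b z (q - z) = 0"
      using repr[of "q - z"] q z by simp
  qed (use deg z in simp)
  \<comment> \<open>This identifies the factor \<open>1 / c\<close> in \<open>repr\<close> with the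
    squared norm of the minimizer.\<close>
  moreover have "semi_inner N lam b z z = 1 / c"
    using repr[OF deg] z by simp
  ultimately show "degree (zeta N lam b m j) \<le> m"
    and "semi_inner N lam b (zeta N lam b m j) (zeta N lam b m j) \<noteq> 0"
    and "degree p \<le> m \<Longrightarrow> semi_inner N lam b (zeta N lam b m j) p =
      (semi_norm N lam b (zeta N lam b m j))\<^sup>2 * poly p (lam j)"
    using deg \<open>c \<noteq> 0\<close> repr by (simp_all add: semi_norm_power2)
qed

text \<open>A trivial kernel means a nonzero determinant, hence a unit of the matrix ring. This
  excludes the value \<open>None\<close>, so \<open>the\<close> extracts a genuine inverse.\<close>

lemma mat_inverse_of_trivial_kernel:
  fixes M :: "'a::field mat"
  assumes M: "M \<in> carrier_mat k k"
    and ker: "\<And>x. x \<in> carrier_vec k \<Longrightarrow> M *\<^sub>v x = 0\<^sub>v k \<Longrightarrow> x = 0\<^sub>v k"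
  shows "invertible_mat M" and "M * the (mat_inverse M) = 1\<^sub>m k"
    and "the (mat_inverse M) \<in> carrier_mat k k"
proof -
  have "Determinant.det M \<noteq> 0"
    using det_0_iff_vec_prod_zero_field[OF M] ker by blast
  then have "M \<in> Units (ring_mat TYPE('a) k ())"
    by (rule det_non_zero_imp_unit[OF M])
  then obtain N where N: "mat_inverse M = Some N"
    using mat_inverse(1)[OF M, of "()"] by (cases "mat_inverse M") auto
  note inv = mat_inverse(2)[OF M N]
  then show "M * the (mat_inverse M) = 1\<^sub>m k" "the (mat_inverse M) \<in> carrier_mat k k"
    by (simp_all add: N)
  show "invertible_mat M"
    unfolding invertible_mat_def inverts_mat_def using M inv by auto
qed

section \<open>The linear system for the correction and the formula for the new minimizer\<close>

theorem lemma3p2: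
  fixes d d' n :: nat
    and lam b :: "nat \<Rightarrow> real"
    and B C D :: "real mat"
    and w \<sigma> :: "real vec"
  assumes "1 \<le> d" and "d \<le> d'"
    and "n \<in> {1..vec_space.grade d (mat_diag d (\<lambda>i. lam (i + 1))) (vec d (\<lambda>i. b (i + 1)))}"
    and "B = mat_diag (d' - d) (\<lambda>i. b (d + 1 + i))"
    and "C = mat (d' - d) (d' - d)
               (\<lambda>(i, j). poly (zeta d lam b (n - 1) (d + 1 + j)) (lam (d + 1 + i)))"
    and "D = mat_diag (d' - d) (\<lambda>i. (semi_norm d lam b (zeta d lam b (n - 1) (d + 1 + i)))\<^sup>2)"
    and "w = vec (d' - d) (\<lambda>i. poly (monic_min d lam b n) (lam (d + 1 + i)))"
    and "\<sigma> = (the (mat_inverse (D + B ^\<^sub>m 2 * C)) * B ^\<^sub>m 2) *\<^sub>v w"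
  shows "invertible_mat (D + B ^\<^sub>m 2 * C) \<and>
    monic_min d' lam b n =
      monic_min d lam b n
      - (\<Sum>j=d+1..d'. Polynomial.smult (\<sigma> $ (j - (d + 1))) (zeta d lam b (n - 1) j))"
proof -
  define m where "m = n - 1"
  have n: "n = Suc m"
    using assms(3) by (simp add: m_def)
  have def: "definite_upto d lam b m"
    unfolding m_def by (rule definite_below_grade[OF assms(3)])
  have def': "definite_upto d' lam b m"
    by (rule definite_upto_mono_nodes[OF def \<open>d \<le> d'\<close>])
  define k where "k = d' - d"
  define M where "M = D + B ^\<^sub>m 2 * C"
  define \<pi> where "\<pi> = monic_min d lam b n"
  \<comment> \<open>Matrix and vector indices start at 0: position \<open>i < k\<close> stands for
    the node \<open>d + 1 + i\<close>.\<close>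
  define Z where "Z i = zeta d lam b m (d + 1 + i)" for i
  define \<mu> where "\<mu> i = lam (d + 1 + i)" for i
  define \<beta> where "\<beta> i = (b (d + 1 + i))\<^sup>2" for i
  define \<delta> where "\<delta> i = (semi_norm d lam b (Z i))\<^sup>2" for i
  define f where "f x = (\<Sum>i<k. Polynomial.smult (x $ i) (Z i))" for x
  note defs = \<open>B = _\<close> \<open>C = _\<close> \<open>D = _\<close> \<open>w = _\<close>
  \<comment> \<open>Polymorphic, as it reindexes sums of reals and also a sum of
    polynomials.\<close>
  have shift: "(\<Sum>j=d+1..d'. g j) = (\<Sum>i<k. g (d + 1 + i))" for g :: "nat \<Rightarrow> 'c::comm_monoid_add"
    by (rule sum.reindex_bij_witness[of _ "\<lambda>i. d + 1 + i" "\<lambda>j. j - (d + 1)"]) (auto simp: k_def)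
  have B2: "B ^\<^sub>m 2 = mat_diag k \<beta>"
    by (simp add: defs mat_diag_pow k_def \<beta>_def[abs_def])
  have M_carrier: "M \<in> carrier_mat k k"
    unfolding M_def B2 unfolding defs k_def[symmetric]
    by (intro add_carrier_mat mult_carrier_mat[of _ k k]) auto
  have M_index: "M $$ (i, j) = (if i = j then \<delta> i else 0) + \<beta> i * poly (Z j) (\<mu> i)"
    if "i < k" "j < k" for i j
    using that unfolding M_def B2 unfolding defs k_def[symmetric] m_def[symmetric]
    by (subst mat_diag_mult_left[of _ k k]) (auto simp: mat_diag_def Z_def \<mu>_def \<delta>_def)
  have poly_f: "poly (f x) t = (\<Sum>j<k. x $ j * poly (Z j) t)" for x t
    by (simp add: f_def poly_sum)
  \<comment> \<open>In \<open>C\<close> the column selects the polynomial and the row the node, so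
    row \<open>i\<close> of \<open>C\<close> applied to \<open>x\<close> evaluates
    \<open>f x\<close> at \<open>\<mu> i\<close>.\<close>
  have M_apply: "(M *\<^sub>v x) $ i = \<delta> i * x $ i + \<beta> i * poly (f x) (\<mu> i)"
    if "x \<in> carrier_vec k" "i < k" for x i
  proof -
    have "(M *\<^sub>v x) $ i = (\<Sum>j<k. M $$ (i, j) * x $ j)"
      using that M_carrier by (simp add: scalar_prod_def atLeast0LessThan)
    also have "\<dots> = (\<Sum>j<k. (if i = j then \<delta> i * x $ j else 0) + \<beta> i * (x $ j * poly (Z j) (\<mu> i)))"
      using that by (intro sum.cong) (auto simp: M_index algebra_simps)
    finally show ?thesis
      using that by (simp add: sum.distrib poly_f sum_distrib_left)
  qed
  have deg_f: "degree (f x) \<le> m" for x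
    unfolding f_def Z_def
    by (intro degree_sum_le) (auto intro: order_trans[OF degree_smult_le] zeta_reproducing(1)[OF def])
  \<comment> \<open>The first \<open>d\<close> nodes give the part of \<open>D\<close>, by the
    reproducing property; the added nodes give the part of \<open>B ^\<^sub>m 2 * C\<close>.\<close>
  have inner_f: "semi_inner d' lam b (f x) p = (\<Sum>i<k. (M *\<^sub>v x) $ i * poly p (\<mu> i))"
    if x: "x \<in> carrier_vec k" and p: "degree p \<le> m" for x p
  proof -
    have "semi_inner d lam b (f x) p = (\<Sum>i<k. \<delta> i * x $ i * poly p (\<mu> i))"
      unfolding f_def semi_inner_sum_left semi_inner_smult_left Z_def
      by (simp add: zeta_reproducing(3)[OF def p] \<delta>_def Z_def \<mu>_def mult_ac)
    then show ?thesis
      unfolding semi_inner_split[OF \<open>d \<le> d'\<close>] shift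
      by (simp add: M_apply[OF x] algebra_simps sum.distrib \<mu>_def \<beta>_def)
  qed
  have ker: "x = 0\<^sub>v k" if x: "x \<in> carrier_vec k" and Mx: "M *\<^sub>v x = 0\<^sub>v k" for x
  proof (rule eq_vecI)
    have "semi_inner d' lam b (f x) (f x) = 0"
      using inner_f[OF x deg_f] Mx by simp
    then have f0: "f x = 0"
      by (rule definite_uptoD[OF def' deg_f])
    fix i assume "i < dim_vec (0\<^sub>v k :: real vec)"
    then have "i < k" by simp
    \<comment> \<open>\<open>f x = 0\<close> alone does not yield \<open>x = 0\<close>, as the
      \<open>Z j\<close> may be linearly dependent. But row \<open>i\<close> of the system now loses
      its evaluation term, and the remaining diagonal factor is nonzero.\<close>
    then have "\<delta> i * x $ i = 0"
      using M_apply[OF x \<open>i < k\<close>] Mx f0 by simp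
    then show "x $ i = 0\<^sub>v k $ i"
      using zeta_reproducing(2)[OF def, of "d + 1 + i"] \<open>i < k\<close>
      by (simp add: \<delta>_def Z_def semi_norm_power2)
  qed (use x in simp)
  note inv = mat_inverse_of_trivial_kernel[OF M_carrier ker]
  have w: "w \<in> carrier_vec k"
    by (simp add: defs k_def)
  have B2_carrier: "B ^\<^sub>m 2 \<in> carrier_mat k k"
    by (simp add: B2)
  have \<sigma>: "\<sigma> \<in> carrier_vec k"
    using inv(3) w B2_carrier unfolding \<open>\<sigma> = _\<close> M_def[symmetric] by auto
  have "M *\<^sub>v \<sigma> = (M * (the (mat_inverse M) * B ^\<^sub>m 2)) *\<^sub>v w"
    unfolding \<open>\<sigma> = _\<close> M_def[symmetric]
    by (rule assoc_mult_mat_vec[symmetric, OF M_carrier mult_carrier_mat[OF inv(3) B2_carrier] w])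
  also have "\<dots> = B ^\<^sub>m 2 *\<^sub>v w"
    by (simp only: assoc_mult_mat[OF M_carrier inv(3) B2_carrier, symmetric] inv(2)
        left_mult_one_mat[OF B2_carrier])
  finally have M\<sigma>: "M *\<^sub>v \<sigma> = B ^\<^sub>m 2 *\<^sub>v w" .
  have B2w: "(B ^\<^sub>m 2 *\<^sub>v w) $ i = \<beta> i * poly \<pi> (\<mu> i)" if "i < k" for i
  proof -
    have "(B ^\<^sub>m 2 *\<^sub>v w) $ i = (\<Sum>j<k. (if i = j then \<beta> j else 0) * poly \<pi> (\<mu> j))"
      using that unfolding B2 \<open>w = _\<close> k_def[symmetric]
      by (simp add: mat_diag_def \<pi>_def \<mu>_def scalar_prod_def atLeast0LessThan)
    also have "\<dots> = (\<Sum>j<k. if i = j then \<beta> j * poly \<pi> (\<mu> j) else 0)"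
      by (intro sum.cong) auto
    finally show ?thesis
      using that by simp
  qed
  have "monic_min d' lam b n = \<pi> - f \<sigma>"
    unfolding n
  proof (rule monic_min_eqI[OF def'])
    \<comment> \<open>The correction has degree at most \<open>m\<close>, so the result stays
      monic.\<close>
    show "degree (\<pi> - f \<sigma>) \<le> Suc m"
      using monic_min_orthogonal(1)[OF def] deg_f[of \<sigma>]
      by (intro degree_diff_le) (auto simp: \<pi>_def n)
    show "coeff (\<pi> - f \<sigma>) (Suc m) = 1"
      using monic_min_orthogonal(2)[OF def] deg_f[of \<sigma>] by (simp add: \<pi>_def n coeff_eq_0)
    fix p :: "real poly"
    assume p: "degree p \<le> m"
    \<comment> \<open>\<open>\<pi>\<close> is orthogonal to \<open>p\<close> over the first
      \<open>d\<close> nodes. Only the added nodes remain, with coefficients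
      \<open>B ^\<^sub>m 2 *\<^sub>v w\<close>, which equal
      \<open>M *\<^sub>v \<sigma>\<close>.\<close>
    have "semi_inner d' lam b \<pi> p = (\<Sum>i<k. \<beta> i * poly \<pi> (\<mu> i) * poly p (\<mu> i))"
      using monic_min_orthogonal(3)[OF def p]
      unfolding semi_inner_split[OF \<open>d \<le> d'\<close>] shift by (simp add: \<pi>_def n \<mu>_def \<beta>_def)
    also have "\<dots> = semi_inner d' lam b (f \<sigma>) p"
      unfolding inner_f[OF \<sigma> p] M\<sigma> by (simp add: B2w)
    finally show "semi_inner d' lam b (\<pi> - f \<sigma>) p = 0"
      by (simp add: semi_inner_diff_left)
  qed
  moreover have "f \<sigma> = (\<Sum>j=d+1..d'. Polynomial.smult (\<sigma> $ (j - (d + 1))) (zeta d lam b (n - 1) j))"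
    unfolding shift f_def Z_def m_def by simp
  ultimately show ?thesis
    using inv(1) by (simp add: M_def \<pi>_def)
qed

end
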